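(* Let $\mathbf{F}$ be a fibration category in which all objects are cofibrant and $\ast$-fibrant and in which a morphism is a weak equivalence if and only if it is a homotopy equivalence. Call a morphism of $\mathbf{F}$ a cofibration if it has the left lifting property with respect to the trivial fibrations. Suppose that $\mathbf{F}$ has an initial object $\emptyset$, that the pushout of two morphisms one of which is a cofibration exists, and that for every object $X$ the morphism $(id_X,id_X):X\coprod X\to X$ admits a factorization into a cofibration followed by a weak equivalence. Then $\mathbf{F}$ (with these cofibrations and its given weak equivalences) is a cofibration category. All objects are $\emptyset$-cofibrant and fibrant.
   Context: A fibration category (Baues) is a category with a final object $\ast$ and two classes of morphisms, weak equivalences and fibrations, such that (a trivial fibration being both a fibration and a weak equivalence): (F1) Isomorphisms are trivial fibrations; composites of two fibrations are fibrations; if two of $f$, $g$, $g\circ f$ are weak equivalences, so is the third. (F2) The pullback of two morphisms one of which is a fibration exists; fibrations and trivial fibrations are stable under base change; the base extension of a weak equivalence along a fibration is a weak equivalence. (F3) Every morphism factors as a weak equivalence followed by a fibration. (F4) For each object $X$ there is a trivial fibration $Y\to X$ with $Y$ cofibrant, meaning that every trivial fibration $E\to Y$ admits a section. $X$ is $\ast$-fibrant if $X\to\ast$ is a fibration. For $X$ cofibrant and $Y$ $\ast$-fibrant, two morphisms $f,g:X\to Y$ are homotopic if for some factorization of $(id_Y,id_Y):Y\to Y\times Y$ into a weak equivalence $Y\to P$ and a fibration $q:P\to Y\times Y$ there is $h:X\to P$ with $q\circ h=(f,g)$. A homotopy equivalence is a morphism invertible up to this relation. A cofibration category is a category with an initial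 object $\emptyset$ and two classes of morphisms, weak equivalences and cofibrations, such that (a trivial cofibration being both a cofibration and a weak equivalence): (C1) Isomorphisms are trivial cofibrations; composites of two cofibrations are cofibrations; if two of $f$, $g$, $g\circ f$ are weak equivalences, so is the third. (C2) The pushout of two morphisms one of which is a cofibration exists; cofibrations and trivial cofibrations are stable under cobase change; the cobase extension of a weak equivalence along a cofibration is a weak equivalence. (C3) Every morphism factors as a cofibration followed by a weak equivalence. (C4) For each object $X$ there is a trivial cofibration $X\to Y$ with $Y$ fibrant, meaning that every trivial cofibration $Y\to Q$ admits a retraction. $X$ is $\emptyset$-cofibrant if $\emptyset\to X$ is a cofibration. (In the setting of the claim, the coproducts $X\coprod X$ exist because every initial morphism $\emptyset\to X$ is a cofibration.) *)

theory Defs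
  imports Main
begin

section \<open>Categories\<close>

text \<open>Composition is written in the usual order and is meaningful only on composable pairs:
  \<open>g \<cdot> f\<close> is \<open>f\<close> followed by \<open>g\<close>.\<close>

record ('o, 'm) cat =
  Obj :: "'o set"
  Arr :: "'m set"
  Dom :: "'m \<Rightarrow> 'o"
  Cod :: "'m \<Rightarrow> 'o"
  Id  :: "'o \<Rightarrow> 'm"
  Comp :: "'m \<Rightarrow> 'm \<Rightarrow> 'm"  (infixl "\<cdot>\<index>" 70)

definition hom :: "('o, 'm, 'z) cat_scheme \<Rightarrow> 'o \<Rightarrow> 'o \<Rightarrow> 'm set" where
  "hom C X Y = {f \<in> Arr C. Dom C f = X \<and> Cod C f = Y}"

locale category =
  fixes C :: "('o, 'm, 'z) cat_scheme" (structure)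
  assumes dom_obj: "f \<in> Arr C \<Longrightarrow> Dom C f \<in> Obj C"
    and cod_obj: "f \<in> Arr C \<Longrightarrow> Cod C f \<in> Obj C"
    and id_hom: "X \<in> Obj C \<Longrightarrow> Id C X \<in> hom C X X"
    and comp_hom: "f \<in> hom C X Y \<Longrightarrow> g \<in> hom C Y Z \<Longrightarrow> g \<cdot> f \<in> hom C X Z"
    and comp_id_right: "f \<in> hom C X Y \<Longrightarrow> f \<cdot> Id C X = f"
    and comp_id_left: "f \<in> hom C X Y \<Longrightarrow> Id C Y \<cdot> f = f"
    and comp_assoc: "f \<in> hom C X Y \<Longrightarrow> g \<in> hom C Y Z \<Longrightarrow> h \<in> hom C Z V \<Longrightarrow>
          (h \<cdot> g) \<cdot> f = h \<cdot> (g \<cdot> f)"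

definition is_iso :: "('o, 'm, 'z) cat_scheme \<Rightarrow> 'm \<Rightarrow> bool" where
  "is_iso C f \<longleftrightarrow> f \<in> Arr C \<and>
     (\<exists>g \<in> hom C (Cod C f) (Dom C f).
        g \<cdot>\<^bsub>C\<^esub> f = Id C (Dom C f) \<and> f \<cdot>\<^bsub>C\<^esub> g = Id C (Cod C f))"

definition is_final :: "('o, 'm, 'z) cat_scheme \<Rightarrow> 'o \<Rightarrow> bool" where
  "is_final C t \<longleftrightarrow> t \<in> Obj C \<and> (\<forall>X \<in> Obj C. \<exists>!f. f \<in> hom C X t)"

definition is_initial :: "('o, 'm, 'z) cat_scheme \<Rightarrow> 'o \<Rightarrow> bool" where
  "is_initial C e \<longleftrightarrow> e \<in> Obj C \<and> (\<forall>X \<in> Obj C. \<exists>!f. f \<in> hom C e X)"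

text \<open>\<open>is_pullback C f g p q\<close>: the square \<open>f \<cdot> p = g \<cdot> q\<close> is cartesian, so \<open>q\<close> is the base change
  of \<open>f\<close> along \<open>g\<close>, and \<open>p\<close> that of \<open>g\<close> along \<open>f\<close>.\<close>

definition is_pullback :: "('o, 'm, 'z) cat_scheme \<Rightarrow> 'm \<Rightarrow> 'm \<Rightarrow> 'm \<Rightarrow> 'm \<Rightarrow> bool" where
  "is_pullback C f g p q \<longleftrightarrow>
     f \<in> Arr C \<and> g \<in> Arr C \<and> p \<in> Arr C \<and> q \<in> Arr C \<and>
     Cod C f = Cod C g \<and> Dom C p = Dom C q \<and> Cod C p = Dom C f \<and> Cod C q = Dom C g \<and>
     f \<cdot>\<^bsub>C\<^esub> p = g \<cdot>\<^bsub>C\<^esub> q \<and>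
     (\<forall>T \<in> Obj C. \<forall>a \<in> hom C T (Dom C f). \<forall>b \<in> hom C T (Dom C g). f \<cdot>\<^bsub>C\<^esub> a = g \<cdot>\<^bsub>C\<^esub> b \<longrightarrow>
        (\<exists>!u. u \<in> hom C T (Dom C p) \<and> p \<cdot>\<^bsub>C\<^esub> u = a \<and> q \<cdot>\<^bsub>C\<^esub> u = b))"

text \<open>\<open>is_pushout C f g p q\<close>: the square \<open>p \<cdot> f = q \<cdot> g\<close> is cocartesian, so \<open>q\<close> is the cobase change
  of \<open>f\<close> along \<open>g\<close>, and \<open>p\<close> that of \<open>g\<close> along \<open>f\<close>.\<close>

definition is_pushout :: "('o, 'm, 'z) cat_scheme \<Rightarrow> 'm \<Rightarrow> 'm \<Rightarrow> 'm \<Rightarrow> 'm \<Rightarrow> bool" where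
  "is_pushout C f g p q \<longleftrightarrow>
     f \<in> Arr C \<and> g \<in> Arr C \<and> p \<in> Arr C \<and> q \<in> Arr C \<and>
     Dom C f = Dom C g \<and> Cod C p = Cod C q \<and> Dom C p = Cod C f \<and> Dom C q = Cod C g \<and>
     p \<cdot>\<^bsub>C\<^esub> f = q \<cdot>\<^bsub>C\<^esub> g \<and>
     (\<forall>T \<in> Obj C. \<forall>a \<in> hom C (Cod C f) T. \<forall>b \<in> hom C (Cod C g) T. a \<cdot>\<^bsub>C\<^esub> f = b \<cdot>\<^bsub>C\<^esub> g \<longrightarrow>
        (\<exists>!u. u \<in> hom C (Cod C p) T \<and> u \<cdot>\<^bsub>C\<^esub> p = a \<and> u \<cdot>\<^bsub>C\<^esub> q = b))"

text \<open>\<open>is_pairing C p1 p2 f g u\<close>: \<open>u\<close> is the morphism \<open>(f, g)\<close> into the product with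
  projections \<open>p1\<close> and \<open>p2\<close>; dually for \<open>is_copairing\<close>.\<close>

definition is_pairing :: "('o, 'm, 'z) cat_scheme \<Rightarrow> 'm \<Rightarrow> 'm \<Rightarrow> 'm \<Rightarrow> 'm \<Rightarrow> 'm \<Rightarrow> bool" where
  "is_pairing C p1 p2 f g u \<longleftrightarrow>
     u \<in> hom C (Dom C f) (Dom C p1) \<and> p1 \<cdot>\<^bsub>C\<^esub> u = f \<and> p2 \<cdot>\<^bsub>C\<^esub> u = g"

definition is_copairing :: "('o, 'm, 'z) cat_scheme \<Rightarrow> 'm \<Rightarrow> 'm \<Rightarrow> 'm \<Rightarrow> 'm \<Rightarrow> 'm \<Rightarrow> bool" where
  "is_copairing C i1 i2 f g u \<longleftrightarrow>
     u \<in> hom C (Cod C i1) (Cod C f) \<and> u \<cdot>\<^bsub>C\<^esub> i1 = f \<and> u \<cdot>\<^bsub>C\<^esub> i2 = g"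

definition is_product :: "('o, 'm, 'z) cat_scheme \<Rightarrow> 'o \<Rightarrow> 'o \<Rightarrow> 'm \<Rightarrow> 'm \<Rightarrow> bool" where
  "is_product C X Y p1 p2 \<longleftrightarrow>
     p1 \<in> Arr C \<and> p2 \<in> Arr C \<and> Dom C p1 = Dom C p2 \<and> Cod C p1 = X \<and> Cod C p2 = Y \<and>
     (\<forall>T \<in> Obj C. \<forall>f \<in> hom C T X. \<forall>g \<in> hom C T Y. \<exists>!u. is_pairing C p1 p2 f g u)"

definition is_coproduct :: "('o, 'm, 'z) cat_scheme \<Rightarrow> 'o \<Rightarrow> 'o \<Rightarrow> 'm \<Rightarrow> 'm \<Rightarrow> bool" where
  "is_coproduct C X Y i1 i2 \<longleftrightarrow>
     i1 \<in> Arr C \<and> i2 \<in> Arr C \<and> Cod C i1 = Cod C i2 \<and> Dom C i1 = X \<and> Dom C i2 = Y \<and>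
     (\<forall>T \<in> Obj C. \<forall>f \<in> hom C X T. \<forall>g \<in> hom C Y T. \<exists>!u. is_copairing C i1 i2 f g u)"

text \<open>\<open>i\<close> has the left lifting property with respect to \<open>p\<close>.\<close>

definition has_llp :: "('o, 'm, 'z) cat_scheme \<Rightarrow> 'm \<Rightarrow> 'm \<Rightarrow> bool" where
  "has_llp C i p \<longleftrightarrow>
     (\<forall>u \<in> hom C (Dom C i) (Dom C p). \<forall>v \<in> hom C (Cod C i) (Cod C p).
        p \<cdot>\<^bsub>C\<^esub> u = v \<cdot>\<^bsub>C\<^esub> i \<longrightarrow>
        (\<exists>h \<in> hom C (Cod C i) (Dom C p). h \<cdot>\<^bsub>C\<^esub> i = u \<and> p \<cdot>\<^bsub>C\<^esub> h = v))"


section \<open>Fibration categories\<close>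

definition cofibrant :: "('o, 'm, 'z) cat_scheme \<Rightarrow> 'm set \<Rightarrow> 'm set \<Rightarrow> 'o \<Rightarrow> bool" where
  "cofibrant C W F Y \<longleftrightarrow> Y \<in> Obj C \<and>
     (\<forall>p \<in> W \<inter> F. Cod C p = Y \<longrightarrow> (\<exists>s \<in> hom C Y (Dom C p). p \<cdot>\<^bsub>C\<^esub> s = Id C Y))"

locale fibration_category = category C
  for C :: "('o, 'm, 'z) cat_scheme" (structure) +
  fixes t :: 'o and W F :: "'m set"
  assumes final: "is_final C t"
    and W_arr: "W \<subseteq> Arr C"
    and F_arr: "F \<subseteq> Arr C"
    and F1_iso: "is_iso C f \<Longrightarrow> f \<in> W \<inter> F"
    and F1_comp: "f \<in> F \<Longrightarrow> g \<in> F \<Longrightarrow> Cod C f = Dom C g \<Longrightarrow> g \<cdot> f \<in> F"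
    and F1_two_of_three: "f \<in> Arr C \<Longrightarrow> g \<in> Arr C \<Longrightarrow> Cod C f = Dom C g \<Longrightarrow>
          (f \<in> W \<and> g \<in> W \<longrightarrow> g \<cdot> f \<in> W) \<and>
          (f \<in> W \<and> g \<cdot> f \<in> W \<longrightarrow> g \<in> W) \<and>
          (g \<in> W \<and> g \<cdot> f \<in> W \<longrightarrow> f \<in> W)"
    and F2_ex: "f \<in> Arr C \<Longrightarrow> g \<in> Arr C \<Longrightarrow> Cod C f = Cod C g \<Longrightarrow> f \<in> F \<or> g \<in> F \<Longrightarrow>
          \<exists>p q. is_pullback C f g p q"
    and F2_fib: "is_pullback C f g p q \<Longrightarrow> f \<in> F \<Longrightarrow> q \<in> F"
    and F2_triv: "is_pullback C f g p q \<Longrightarrow> f \<in> W \<inter> F \<Longrightarrow> q \<in> W \<inter> F"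
    and F2_proper: "is_pullback C f g p q \<Longrightarrow> f \<in> W \<Longrightarrow> g \<in> F \<Longrightarrow> q \<in> W"
    and F3: "f \<in> Arr C \<Longrightarrow> \<exists>w \<in> W. \<exists>p \<in> F. Cod C w = Dom C p \<and> p \<cdot> w = f"
    and F4: "X \<in> Obj C \<Longrightarrow> \<exists>p \<in> W \<inter> F. Cod C p = X \<and> cofibrant C W F (Dom C p)"

definition final_fibrant :: "('o, 'm, 'z) cat_scheme \<Rightarrow> 'o \<Rightarrow> 'm set \<Rightarrow> 'o \<Rightarrow> bool" where
  "final_fibrant C t F X \<longleftrightarrow> X \<in> Obj C \<and> (\<exists>f \<in> hom C X t. f \<in> F)"

text \<open>The product \<open>Y \<times> Y\<close> is given by its projections \<open>p1, p2\<close>; \<open>d\<close> is the diagonal \<open>(id, id)\<close>.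
  The relation is only meant for a cofibrant source and a fibrant target, and these
  conditions are part of it.\<close>

definition homotopic ::
    "('o, 'm, 'z) cat_scheme \<Rightarrow> 'o \<Rightarrow> 'm set \<Rightarrow> 'm set \<Rightarrow> 'm \<Rightarrow> 'm \<Rightarrow> bool" where
  "homotopic C t W F f g \<longleftrightarrow>
     (\<exists>X Y. cofibrant C W F X \<and> final_fibrant C t F Y \<and> f \<in> hom C X Y \<and> g \<in> hom C X Y \<and>
       (\<exists>p1 p2 d. is_product C Y Y p1 p2 \<and> is_pairing C p1 p2 (Id C Y) (Id C Y) d \<and>
         (\<exists>w \<in> W. \<exists>q \<in> F. Cod C w = Dom C q \<and> q \<cdot>\<^bsub>C\<^esub> w = d \<and>
           (\<exists>h \<in> hom C X (Dom C q). is_pairing C p1 p2 f g (q \<cdot>\<^bsub>C\<^esub> h)))))"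

definition homotopy_equivalence ::
    "('o, 'm, 'z) cat_scheme \<Rightarrow> 'o \<Rightarrow> 'm set \<Rightarrow> 'm set \<Rightarrow> 'm \<Rightarrow> bool" where
  "homotopy_equivalence C t W F f \<longleftrightarrow> f \<in> Arr C \<and>
     (\<exists>g \<in> hom C (Cod C f) (Dom C f).
        homotopic C t W F (g \<cdot>\<^bsub>C\<^esub> f) (Id C (Dom C f)) \<and>
        homotopic C t W F (f \<cdot>\<^bsub>C\<^esub> g) (Id C (Cod C f)))"

definition cofibrations :: "('o, 'm, 'z) cat_scheme \<Rightarrow> 'm set \<Rightarrow> 'm set \<Rightarrow> 'm set" where
  "cofibrations C W F = {i \<in> Arr C. \<forall>p \<in> W \<inter> F. has_llp C i p}"


section \<open>Cofibration categories\<close>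

definition fibrant :: "('o, 'm, 'z) cat_scheme \<Rightarrow> 'm set \<Rightarrow> 'm set \<Rightarrow> 'o \<Rightarrow> bool" where
  "fibrant C W K Y \<longleftrightarrow> Y \<in> Obj C \<and>
     (\<forall>i \<in> W \<inter> K. Dom C i = Y \<longrightarrow> (\<exists>r \<in> hom C (Cod C i) Y. r \<cdot>\<^bsub>C\<^esub> i = Id C Y))"

locale cofibration_category = category C
  for C :: "('o, 'm, 'z) cat_scheme" (structure) +
  fixes e :: 'o and W K :: "'m set"
  assumes initial: "is_initial C e"
    and W_arr: "W \<subseteq> Arr C"
    and K_arr: "K \<subseteq> Arr C"
    and C1_iso: "is_iso C f \<Longrightarrow> f \<in> W \<inter> K"
    and C1_comp: "f \<in> K \<Longrightarrow> g \<in> K \<Longrightarrow> Cod C f = Dom C g \<Longrightarrow> g \<cdot> f \<in> K"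
    and C1_two_of_three: "f \<in> Arr C \<Longrightarrow> g \<in> Arr C \<Longrightarrow> Cod C f = Dom C g \<Longrightarrow>
          (f \<in> W \<and> g \<in> W \<longrightarrow> g \<cdot> f \<in> W) \<and>
          (f \<in> W \<and> g \<cdot> f \<in> W \<longrightarrow> g \<in> W) \<and>
          (g \<in> W \<and> g \<cdot> f \<in> W \<longrightarrow> f \<in> W)"
    and C2_ex: "f \<in> Arr C \<Longrightarrow> g \<in> Arr C \<Longrightarrow> Dom C f = Dom C g \<Longrightarrow> f \<in> K \<or> g \<in> K \<Longrightarrow>
          \<exists>p q. is_pushout C f g p q"
    and C2_cof: "is_pushout C f g p q \<Longrightarrow> f \<in> K \<Longrightarrow> q \<in> K"
    and C2_triv: "is_pushout C f g p q \<Longrightarrow> f \<in> W \<inter> K \<Longrightarrow> q \<in> W \<inter> K"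
    and C2_proper: "is_pushout C f g p q \<Longrightarrow> f \<in> W \<Longrightarrow> g \<in> K \<Longrightarrow> q \<in> W"
    and C3: "f \<in> Arr C \<Longrightarrow> \<exists>i \<in> K. \<exists>w \<in> W. Cod C i = Dom C w \<and> w \<cdot> i = f"
    and C4: "X \<in> Obj C \<Longrightarrow> \<exists>i \<in> W \<inter> K. Dom C i = X \<and> fibrant C W K (Cod C i)"

definition initial_cofibrant :: "('o, 'm, 'z) cat_scheme \<Rightarrow> 'o \<Rightarrow> 'm set \<Rightarrow> 'o \<Rightarrow> bool" where
  "initial_cofibrant C e K X \<longleftrightarrow> X \<in> Obj C \<and> (\<exists>f \<in> hom C e X. f \<in> K)"

end

theory Submission
  imports Defs
begin

text \<open>The key tool: if \<open>p u = v f\<close> with \<open>f\<close> a weak equivalence and \<open>p\<close> a fibration, then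
  factoring \<open>u\<close> through the base change of \<open>p\<close> along \<open>v\<close> as a weak equivalence followed by a
  fibration replaces \<open>p\<close> by a trivial fibration over the codomain of \<open>f\<close>. Hence trivial
  cofibrations lift against all fibrations, and a general weak equivalence lifts up to fibrewise
  homotopy. Conversely, a morphism with the left lifting property against all fibrations is a retract
  of a weak equivalence, and homotopy equivalences are closed under such retracts; this gives
  stability of trivial cofibrations. For left properness, factor the cobase change \<open>q\<close> of a weak
  equivalence as a weak equivalence \<open>w\<close> followed by a fibration; lifting up to homotopy and the
  homotopy extension property of cofibrations exhibit \<open>q\<close> as a retract of a morphism homotopic
  to \<open>w\<close>. The factorization axiom comes from mapping cylinders.\<close>

section \<open>Categories and lifting properties\<close>

context category
begin

lemma comp_arr [simp]:
  assumes "f \<in> Arr C" "g \<in> Arr C" "Cod C f = Dom C g"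
  shows "g \<cdot> f \<in> Arr C" "Dom C (g \<cdot> f) = Dom C f" "Cod C (g \<cdot> f) = Cod C g"
  using comp_hom[of f "Dom C f" "Cod C f" g "Cod C g"] assms by (auto simp: hom_def)

lemma assoc_arr [simp]:
  assumes "f \<in> Arr C" "g \<in> Arr C" "h \<in> Arr C" "Cod C f = Dom C g" "Cod C g = Dom C h"
  shows "(h \<cdot> g) \<cdot> f = h \<cdot> (g \<cdot> f)"
  using comp_assoc[of f "Dom C f" "Cod C f" g "Cod C g" h "Cod C h"] assms by (auto simp: hom_def)

lemma id_arr [simp]:
  assumes "X \<in> Obj C"
  shows "Id C X \<in> Arr C" "Dom C (Id C X) = X" "Cod C (Id C X) = X"
  using id_hom[OF assms] by (auto simp: hom_def)

lemma id_comp [simp]: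
  assumes "f \<in> Arr C"
  shows "Cod C f = X \<Longrightarrow> Id C X \<cdot> f = f" "Dom C f = X \<Longrightarrow> f \<cdot> Id C X = f"
  using comp_id_left[of f "Dom C f" "Cod C f"] comp_id_right[of f "Dom C f" "Cod C f"] assms
  by (auto simp: hom_def)

lemma hom_obj: "f \<in> hom C X Y \<Longrightarrow> X \<in> Obj C" "f \<in> hom C X Y \<Longrightarrow> Y \<in> Obj C"
  using dom_obj cod_obj by (auto simp: hom_def)

lemma arr_hom: "f \<in> Arr C \<Longrightarrow> f \<in> hom C (Dom C f) (Cod C f)"
  by (simp add: hom_def)

text \<open>Associativity in the form needed to rewrite an equation inside a longer composite.\<close>

lemma comp_eq_precomp:
  assumes "g \<in> hom C X Y" "f \<in> hom C Y Z" "g' \<in> hom C X Y'" "f' \<in> hom C Y' Z"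
    and "f \<cdot> g = f' \<cdot> g'" and "x \<in> hom C T X"
  shows "f \<cdot> (g \<cdot> x) = f' \<cdot> (g' \<cdot> x)"
proof -
  have "f \<cdot> (g \<cdot> x) = (f \<cdot> g) \<cdot> x"
    by (rule comp_assoc[OF assms(6,1,2), symmetric])
  also have "\<dots> = (f' \<cdot> g') \<cdot> x" using assms(5) by simp
  also have "\<dots> = f' \<cdot> (g' \<cdot> x)"
    by (rule comp_assoc[OF assms(6,3,4)])
  finally show ?thesis .
qed

lemma comp_eq_arr_precomp:
  assumes "g \<in> hom C X Y" "f \<in> hom C Y Z" "f \<cdot> g = k" and "x \<in> hom C T X"
  shows "f \<cdot> (g \<cdot> x) = k \<cdot> x"
  using comp_assoc[OF assms(4,1,2)] assms(3) by simp

lemma retraction_precomp: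
  assumes "g \<in> hom C X Y" "f \<in> hom C Y X" "f \<cdot> g = Id C X" and "x \<in> hom C T X"
  shows "f \<cdot> (g \<cdot> x) = x"
  using comp_eq_arr_precomp[OF assms] comp_id_left assms(4) by simp

text \<open>The unique existence in the definition is split into an existence rule and a
  cancellation rule, and the vertex gets a name, so that later arguments work with hom-sets instead
  of domains and codomains.\<close>

lemma is_pullbackD:
  assumes pb: "is_pullback C f g p q" and f: "f \<in> hom C X Z" and g: "g \<in> hom C Y Z"
  obtains P where "p \<in> hom C P X" "q \<in> hom C P Y" "f \<cdot> p = g \<cdot> q"
    "\<And>T a b. a \<in> hom C T X \<Longrightarrow> b \<in> hom C T Y \<Longrightarrow> f \<cdot> a = g \<cdot> b \<Longrightarrow>
       \<exists>u \<in> hom C T P. p \<cdot> u = a \<and> q \<cdot> u = b"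
    "\<And>T u u'. u \<in> hom C T P \<Longrightarrow> u' \<in> hom C T P \<Longrightarrow> p \<cdot> u = p \<cdot> u' \<Longrightarrow> q \<cdot> u = q \<cdot> u' \<Longrightarrow> u = u'"
proof (rule that[of "Dom C p"])
  have XY: "Dom C f = X" "Dom C g = Y" using f g by (auto simp: hom_def)
  have sq: "p \<in> Arr C" "q \<in> Arr C" "Dom C p = Dom C q" "Cod C p = Dom C f" "Cod C q = Dom C g"
    and e: "f \<cdot> p = g \<cdot> q"
    and uni: "\<forall>T \<in> Obj C. \<forall>a \<in> hom C T (Dom C f). \<forall>b \<in> hom C T (Dom C g). f \<cdot> a = g \<cdot> b \<longrightarrow>
        (\<exists>!u. u \<in> hom C T (Dom C p) \<and> p \<cdot> u = a \<and> q \<cdot> u = b)"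
    using pb unfolding is_pullback_def by - (elim conjE, assumption)+
  note univ = uni[unfolded XY, THEN bspec, THEN bspec, THEN bspec, THEN mp]
  show p: "p \<in> hom C (Dom C p) X" and q: "q \<in> hom C (Dom C p) Y"
    using sq(1-5) XY by (auto simp: hom_def)
  show "f \<cdot> p = g \<cdot> q" by (rule e)
  show "\<exists>u \<in> hom C T (Dom C p). p \<cdot> u = a \<and> q \<cdot> u = b"
    if "a \<in> hom C T X" "b \<in> hom C T Y" "f \<cdot> a = g \<cdot> b" for T a b
    using univ[OF hom_obj(1)[OF that(1)] that] by (elim ex1E) blast
  show "u = u'" if u: "u \<in> hom C T (Dom C p)" and u': "u' \<in> hom C T (Dom C p)"
    and pu: "p \<cdot> u = p \<cdot> u'" and qu: "q \<cdot> u = q \<cdot> u'" for T u u'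
    by (rule Uniq_D[OF ex1_iff_ex_Uniq[THEN iffD1, THEN conjunct2,
          OF univ[OF hom_obj(1)[OF u] comp_hom[OF u' p] comp_hom[OF u' q]
          comp_eq_precomp[OF p f q g e u']]]])
      (intro conjI u u' pu qu refl)+
qed

lemma is_pushoutD:
  assumes po: "is_pushout C f g p q" and f: "f \<in> hom C Z X" and g: "g \<in> hom C Z Y"
  obtains P where "p \<in> hom C X P" "q \<in> hom C Y P" "p \<cdot> f = q \<cdot> g"
    "\<And>T a b. a \<in> hom C X T \<Longrightarrow> b \<in> hom C Y T \<Longrightarrow> a \<cdot> f = b \<cdot> g \<Longrightarrow>
       \<exists>u \<in> hom C P T. u \<cdot> p = a \<and> u \<cdot> q = b"
    "\<And>T u u'. u \<in> hom C P T \<Longrightarrow> u' \<in> hom C P T \<Longrightarrow> u \<cdot> p = u' \<cdot> p \<Longrightarrow> u \<cdot> q = u' \<cdot> q \<Longrightarrow> u = u'"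
proof (rule that[of "Cod C p"])
  have XY: "Cod C f = X" "Cod C g = Y" using f g by (auto simp: hom_def)
  have sq: "p \<in> Arr C" "q \<in> Arr C" "Cod C p = Cod C q" "Dom C p = Cod C f" "Dom C q = Cod C g"
    and e: "p \<cdot> f = q \<cdot> g"
    and uni: "\<forall>T \<in> Obj C. \<forall>a \<in> hom C (Cod C f) T. \<forall>b \<in> hom C (Cod C g) T. a \<cdot> f = b \<cdot> g \<longrightarrow>
        (\<exists>!u. u \<in> hom C (Cod C p) T \<and> u \<cdot> p = a \<and> u \<cdot> q = b)"
    using po unfolding is_pushout_def by - (elim conjE, assumption)+
  note univ = uni[unfolded XY, THEN bspec, THEN bspec, THEN bspec, THEN mp]
  show p: "p \<in> hom C X (Cod C p)" and q: "q \<in> hom C Y (Cod C p)"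
    using sq(1-5) XY by (auto simp: hom_def)
  show "p \<cdot> f = q \<cdot> g" by (rule e)
  show "\<exists>u \<in> hom C (Cod C p) T. u \<cdot> p = a \<and> u \<cdot> q = b"
    if "a \<in> hom C X T" "b \<in> hom C Y T" "a \<cdot> f = b \<cdot> g" for T a b
    using univ[OF hom_obj(2)[OF that(1)] that] by (elim ex1E) blast
  show "u = u'" if u: "u \<in> hom C (Cod C p) T" and u': "u' \<in> hom C (Cod C p) T"
    and pu: "u \<cdot> p = u' \<cdot> p" and qu: "u \<cdot> q = u' \<cdot> q" for T u u'
  proof -
    \<comment> \<open>Uniqueness is stated for compatible pairs only, so the restrictions of
      \<open>u'\<close> are first shown to be such a pair.\<close>
    have "(u' \<cdot> p) \<cdot> f = u' \<cdot> (p \<cdot> f)" by (rule comp_assoc[OF f p u'])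
    also have "\<dots> = (u' \<cdot> q) \<cdot> g" unfolding e by (rule comp_assoc[OF g q u', symmetric])
    finally have e': "(u' \<cdot> p) \<cdot> f = (u' \<cdot> q) \<cdot> g" .
    show ?thesis
      by (rule Uniq_D[OF ex1_iff_ex_Uniq[THEN iffD1, THEN conjunct2,
            OF univ[OF hom_obj(2)[OF u] comp_hom[OF p u'] comp_hom[OF q u'] e']]])
        (intro conjI u u' pu qu refl)+
  qed
qed

section \<open>The left lifting property and its closure under composition and cobase change\<close>

lemma has_llpD:
  assumes "has_llp C i p" "i \<in> hom C A B" "p \<in> hom C E Y" "u \<in> hom C A E" "v \<in> hom C B Y"
    "p \<cdot> u = v \<cdot> i"
  obtains h where "h \<in> hom C B E" "h \<cdot> i = u" "p \<cdot> h = v"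
  using assms by (auto simp: has_llp_def hom_def)

lemma has_llpI:
  assumes "i \<in> hom C A B" "p \<in> hom C E Y"
    and "\<And>u v. u \<in> hom C A E \<Longrightarrow> v \<in> hom C B Y \<Longrightarrow> p \<cdot> u = v \<cdot> i \<Longrightarrow>
       \<exists>h \<in> hom C B E. h \<cdot> i = u \<and> p \<cdot> h = v"
  shows "has_llp C i p"
  using assms by (auto simp: has_llp_def hom_def)

lemma llp_iso:
  assumes "is_iso C i" "p \<in> Arr C"
  shows "has_llp C i p"
proof -
  obtain g where i: "i \<in> hom C (Dom C i) (Cod C i)" and g: "g \<in> hom C (Cod C i) (Dom C i)"
    "g \<cdot> i = Id C (Dom C i)" "i \<cdot> g = Id C (Cod C i)"
    using assms by (auto simp: is_iso_def hom_def)
  show ?thesis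
  proof (rule has_llpI[OF i arr_hom[OF assms(2)]])
    fix u v assume u: "u \<in> hom C (Dom C i) (Dom C p)" and v: "v \<in> hom C (Cod C i) (Cod C p)"
      and e: "p \<cdot> u = v \<cdot> i"
    have "(u \<cdot> g) \<cdot> i = u" using u i g by (auto simp: hom_def)
    moreover have "p \<cdot> (u \<cdot> g) = v"
      using comp_eq_precomp[OF u arr_hom[OF assms(2)] i v e g(1)] g(3) v by (auto simp: hom_def)
    ultimately show "\<exists>h \<in> hom C (Cod C i) (Dom C p). h \<cdot> i = u \<and> p \<cdot> h = v"
      using comp_hom[OF g(1) u] by blast
  qed
qed

lemma llp_comp:
  assumes i: "i \<in> hom C X Y" and j: "j \<in> hom C Y Z" and p: "p \<in> Arr C"
    and li: "has_llp C i p" and lj: "has_llp C j p"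
  shows "has_llp C (j \<cdot> i) p"
proof (rule has_llpI[OF comp_hom[OF i j] arr_hom[OF p]])
  fix u v assume u: "u \<in> hom C X (Dom C p)" and v: "v \<in> hom C Z (Cod C p)"
    and e: "p \<cdot> u = v \<cdot> (j \<cdot> i)"
  have "p \<cdot> u = (v \<cdot> j) \<cdot> i" using e v i j by (auto simp: hom_def)
  from has_llpD[OF li i arr_hom[OF p] u comp_hom[OF j v] this]
  obtain h where h: "h \<in> hom C Y (Dom C p)" "h \<cdot> i = u" "p \<cdot> h = v \<cdot> j" .
  from has_llpD[OF lj j arr_hom[OF p] h(1) v h(3)]
  obtain k where k: "k \<in> hom C Z (Dom C p)" "k \<cdot> j = h" "p \<cdot> k = v" .
  show "\<exists>h \<in> hom C Z (Dom C p). h \<cdot> (j \<cdot> i) = u \<and> p \<cdot> h = v"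
    using k h comp_eq_arr_precomp[OF j k(1,2) i] by blast
qed

text \<open>Pasting a square for \<open>q\<close> with the pushout square gives a square for
  \<open>f\<close>. Its lift agrees with \<open>u\<close> on the common source, so the two glue to a
  morphism out of the pushout; uniqueness there shows that it also lifts \<open>v\<close>.\<close>

lemma llp_pushout:
  assumes po: "is_pushout C f g j q" and p: "p \<in> Arr C" and l: "has_llp C f p"
  shows "has_llp C q p"
proof -
  have f: "f \<in> hom C (Dom C f) (Cod C f)" and g: "g \<in> hom C (Dom C f) (Cod C g)"
    using po by (auto simp: is_pushout_def hom_def)
  from is_pushoutD[OF po f g] obtain P where P: "j \<in> hom C (Cod C f) P" "q \<in> hom C (Cod C g) P"
    "j \<cdot> f = q \<cdot> g"
    "\<And>T a b. a \<in> hom C (Cod C f) T \<Longrightarrow> b \<in> hom C (Cod C g) T \<Longrightarrow> a \<cdot> f = b \<cdot> g \<Longrightarrow>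
       \<exists>u \<in> hom C P T. u \<cdot> j = a \<and> u \<cdot> q = b"
    "\<And>T u u'. u \<in> hom C P T \<Longrightarrow> u' \<in> hom C P T \<Longrightarrow> u \<cdot> j = u' \<cdot> j \<Longrightarrow> u \<cdot> q = u' \<cdot> q \<Longrightarrow> u = u'"
    by metis
  note ph = arr_hom[OF p]
  show ?thesis
  proof (rule has_llpI[OF P(2) ph])
    fix u v assume u: "u \<in> hom C (Cod C g) (Dom C p)" and v: "v \<in> hom C P (Cod C p)"
      and e: "p \<cdot> u = v \<cdot> q"
    have "p \<cdot> (u \<cdot> g) = (v \<cdot> j) \<cdot> f"
      using comp_eq_precomp[OF u ph P(2) v e g] P(1,3) v f by (auto simp: hom_def)
    from has_llpD[OF l f ph comp_hom[OF g u] comp_hom[OF P(1) v] this]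
    obtain h where h: "h \<in> hom C (Cod C f) (Dom C p)" "h \<cdot> f = u \<cdot> g" "p \<cdot> h = v \<cdot> j" .
    from P(4)[OF h(1) u h(2)] obtain k where k: "k \<in> hom C P (Dom C p)" "k \<cdot> j = h" "k \<cdot> q = u"
      by blast
    have "p \<cdot> k = v"
    proof (rule P(5)[OF comp_hom[OF k(1) ph] v])
      show "(p \<cdot> k) \<cdot> j = v \<cdot> j" "(p \<cdot> k) \<cdot> q = v \<cdot> q"
        using k P(1,2) h(3) e p by (auto simp: hom_def)
    qed
    then show "\<exists>h \<in> hom C P (Dom C p). h \<cdot> q = u \<and> p \<cdot> h = v"
      using k by blast
  qed
qed

end


section \<open>Lifting weak equivalences against fibrations\<close>

locale bifibrant_fibration_category = fibration_category C t W F
  for C :: "('o, 'm, 'z) cat_scheme" (structure) and t :: 'o and W F :: "'m set" +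
  assumes all_cofibrant: "X \<in> Obj C \<Longrightarrow> cofibrant C W F X"
    and all_fibrant: "X \<in> Obj C \<Longrightarrow> final_fibrant C t F X"
    and W_iff: "f \<in> Arr C \<Longrightarrow> f \<in> W \<longleftrightarrow> homotopy_equivalence C t W F f"
begin

lemma W_comp: "f \<in> W \<Longrightarrow> g \<in> W \<Longrightarrow> f \<in> hom C X Y \<Longrightarrow> g \<in> hom C Y Z \<Longrightarrow> g \<cdot> f \<in> W"
  and W_cancel_right: "f \<in> W \<Longrightarrow> g \<cdot> f \<in> W \<Longrightarrow> f \<in> hom C X Y \<Longrightarrow> g \<in> hom C Y Z \<Longrightarrow> g \<in> W"
  and W_cancel_left: "g \<in> W \<Longrightarrow> g \<cdot> f \<in> W \<Longrightarrow> f \<in> hom C X Y \<Longrightarrow> g \<in> hom C Y Z \<Longrightarrow> f \<in> W"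
  using F1_two_of_three[of f g] by (auto simp: hom_def)

lemma id_iso: "X \<in> Obj C \<Longrightarrow> is_iso C (Id C X)"
  by (auto simp: is_iso_def hom_def intro!: exI[of _ "Id C X"])

lemma id_W: "X \<in> Obj C \<Longrightarrow> Id C X \<in> W"
  using F1_iso id_iso by blast

lemma factorization:
  assumes "f \<in> hom C X Y"
  obtains P w p where "w \<in> hom C X P" "p \<in> hom C P Y" "w \<in> W" "p \<in> F" "p \<cdot> w = f"
proof -
  obtain w p where "w \<in> W" "p \<in> F" "Cod C w = Dom C p" "p \<cdot> w = f"
    using F3[of f] assms by (auto simp: hom_def)
  moreover have "w \<in> Arr C" "p \<in> Arr C" using calculation W_arr F_arr by auto
  ultimately show ?thesis using assms that[of w "Dom C p" p] by (auto simp: hom_def)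
qed

lemma fibration_pullback:
  assumes "f \<in> hom C X Z" "g \<in> hom C Y Z" "f \<in> F"
  obtains p q P where "is_pullback C f g p q"
    "p \<in> hom C P X" "q \<in> hom C P Y" "q \<in> F" "f \<cdot> p = g \<cdot> q"
    "\<And>T a b. a \<in> hom C T X \<Longrightarrow> b \<in> hom C T Y \<Longrightarrow> f \<cdot> a = g \<cdot> b \<Longrightarrow>
       \<exists>u \<in> hom C T P. p \<cdot> u = a \<and> q \<cdot> u = b"
    "\<And>T u u'. u \<in> hom C T P \<Longrightarrow> u' \<in> hom C T P \<Longrightarrow> p \<cdot> u = p \<cdot> u' \<Longrightarrow> q \<cdot> u = q \<cdot> u' \<Longrightarrow> u = u'"
proof -
  obtain p q where pb: "is_pullback C f g p q"
    using F2_ex[of f g] assms by (auto simp: hom_def)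
  from is_pullbackD[OF pb assms(1,2)] F2_fib[OF pb assms(3)] pb show ?thesis
    using that by metis
qed

lemma is_pullback_sym: "is_pullback C f g p q \<Longrightarrow> is_pullback C g f q p"
  unfolding is_pullback_def by (auto; metis)

lemma triv_fib_section:
  assumes "p \<in> hom C E B" "p \<in> W \<inter> F"
  obtains s where "s \<in> hom C B E" "p \<cdot> s = Id C B"
  using all_cofibrant[OF hom_obj(2)[OF assms(1)]] assms by (auto simp: cofibrant_def hom_def)

text \<open>Let \<open>q'\<close> be the base change of \<open>p\<close> along \<open>v\<close>, and
  let \<open>x\<close> be the morphism into the pullback induced by \<open>u\<close> and
  \<open>f\<close>. With \<open>x = m \<cdot> j\<close> factored, \<open>r = q' \<cdot> m\<close> is
  a fibration as a composite, and a weak equivalence by two out of three from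
  \<open>r \<cdot> j = f\<close>.\<close>

lemma triv_fib_replacement:
  assumes f: "f \<in> hom C A B" "f \<in> W" and p: "p \<in> hom C E Y" "p \<in> F"
    and u: "u \<in> hom C A E" and v: "v \<in> hom C B Y" and e: "p \<cdot> u = v \<cdot> f"
  obtains Q r j k where "r \<in> hom C Q B" "r \<in> W \<inter> F" "j \<in> hom C A Q" "j \<in> W" "k \<in> hom C Q E"
    "p \<cdot> k = v \<cdot> r" "k \<cdot> j = u" "r \<cdot> j = f"
proof -
  obtain p' q' P where P: "p' \<in> hom C P E" "q' \<in> hom C P B" "q' \<in> F" "p \<cdot> p' = v \<cdot> q'"
    and ex: "\<And>T a b. a \<in> hom C T E \<Longrightarrow> b \<in> hom C T B \<Longrightarrow> p \<cdot> a = v \<cdot> b \<Longrightarrow>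
       \<exists>u \<in> hom C T P. p' \<cdot> u = a \<and> q' \<cdot> u = b"
    using fibration_pullback[OF p(1) v p(2)] by metis
  from ex[OF u f(1) e] obtain x where x: "x \<in> hom C A P" "p' \<cdot> x = u" "q' \<cdot> x = f" by blast
  from factorization[OF x(1)] obtain Q j m
    where j: "j \<in> hom C A Q" "m \<in> hom C Q P" "j \<in> W" "m \<in> F" "m \<cdot> j = x" .
  have r: "q' \<cdot> m \<in> hom C Q B" by (rule comp_hom[OF j(2) P(2)])
  have rF: "q' \<cdot> m \<in> F" using F1_comp[OF j(4) P(3)] j P by (auto simp: hom_def)
  have rj: "(q' \<cdot> m) \<cdot> j = f" and kj: "(p' \<cdot> m) \<cdot> j = u" using j P x by (auto simp: hom_def)
  have rW: "q' \<cdot> m \<in> W" using W_cancel_right[OF j(3) _ j(1) r] rj f(2) by simp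
  have "p \<cdot> (p' \<cdot> m) = v \<cdot> (q' \<cdot> m)"
    by (rule comp_eq_precomp[OF P(1) p(1) P(2) v P(4) j(2)])
  with r rF rW j rj kj comp_hom[OF j(2) P(1)] show ?thesis using that by blast
qed

text \<open>A section of \<open>r\<close> exists because \<open>B\<close> is cofibrant, but nothing
  relates it to \<open>j\<close>. Hence only the lower triangle is asserted to commute.\<close>

lemma weq_lift:
  assumes f: "f \<in> hom C A B" "f \<in> W" and p: "p \<in> hom C E Y" "p \<in> F"
    and u: "u \<in> hom C A E" and v: "v \<in> hom C B Y" and e: "p \<cdot> u = v \<cdot> f"
  obtains h where "h \<in> hom C B E" "p \<cdot> h = v"
proof -
  from triv_fib_replacement[OF assms] obtain Q r j k
    where r: "r \<in> hom C Q B" "r \<in> W \<inter> F" and k: "k \<in> hom C Q E" "p \<cdot> k = v \<cdot> r" by metis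
  obtain s where s: "s \<in> hom C B Q" "r \<cdot> s = Id C B" by (rule triv_fib_section[OF r])
  have "p \<cdot> (k \<cdot> s) = v"
    using comp_eq_precomp[OF k(1) p(1) r(1) v k(2) s(1)] s(2) comp_id_right[OF v] by simp
  with comp_hom[OF s(1) k(1)] show ?thesis using that by blast
qed

text \<open>For a cofibration \<open>i\<close> the section of \<open>r\<close> can be chosen as a
  lift extending \<open>j\<close>, so here the upper triangle commutes as well.\<close>

lemma triv_cof_lift:
  assumes i: "i \<in> W" "i \<in> cofibrations C W F" and p: "p \<in> F"
  shows "has_llp C i p"
proof -
  have ih: "i \<in> hom C (Dom C i) (Cod C i)" and ph: "p \<in> hom C (Dom C p) (Cod C p)"
    using assms F_arr arr_hom by (auto simp: cofibrations_def)
  show ?thesis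
  proof (rule has_llpI[OF ih ph])
    fix u v assume u: "u \<in> hom C (Dom C i) (Dom C p)" and v: "v \<in> hom C (Cod C i) (Cod C p)"
      and e: "p \<cdot> u = v \<cdot> i"
    from triv_fib_replacement[OF ih i(1) ph p u v e] obtain Q r j k
      where r: "r \<in> hom C Q (Cod C i)" "r \<in> W \<inter> F" and j: "j \<in> hom C (Dom C i) Q"
        and k: "k \<in> hom C Q (Dom C p)" and eqs: "p \<cdot> k = v \<cdot> r" "k \<cdot> j = u" "r \<cdot> j = i" .
    have l: "has_llp C i r" using i(2) r(2) by (auto simp: cofibrations_def)
    have "r \<cdot> j = Id C (Cod C i) \<cdot> i" using eqs comp_id_left[OF ih] by simp
    from has_llpD[OF l ih r(1) j id_hom[OF hom_obj(2)[OF ih]] this]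
    obtain s where s: "s \<in> hom C (Cod C i) Q" "s \<cdot> i = j" "r \<cdot> s = Id C (Cod C i)" .
    have "(k \<cdot> s) \<cdot> i = u" using s k eqs ih by (auto simp: hom_def)
    moreover have "p \<cdot> (k \<cdot> s) = v"
      using comp_eq_precomp[OF k ph r(1) v eqs(1) s(1)] s(3) comp_id_right[OF v] by simp
    ultimately show "\<exists>h \<in> hom C (Cod C i) (Dom C p). h \<cdot> i = u \<and> p \<cdot> h = v"
      using comp_hom[OF s(1) k] by blast
  qed
qed

text \<open>\<open>P\<close> is a path object of \<open>E\<close> over \<open>Y\<close>; the last property replaces the fibration
  \<open>P \<rightarrow> E \<times>\<^bsub>Y\<^esub> E\<close>.\<close>

lemma relative_path_object:
  assumes p: "p \<in> hom C E Y" "p \<in> F"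
  obtains P a b where "a \<in> hom C P E" "b \<in> hom C P E" "a \<in> W \<inter> F" "b \<in> W \<inter> F" "p \<cdot> a = p \<cdot> b"
    "\<And>A B f x y. f \<in> hom C A B \<Longrightarrow> f \<in> W \<Longrightarrow> x \<in> hom C B E \<Longrightarrow> y \<in> hom C B E \<Longrightarrow>
       p \<cdot> x = p \<cdot> y \<Longrightarrow> x \<cdot> f = y \<cdot> f \<Longrightarrow> \<exists>h \<in> hom C B P. a \<cdot> h = x \<and> b \<cdot> h = y"
proof -
  obtain p1 p2 D where pb: "is_pullback C p p p1 p2"
    and D: "p1 \<in> hom C D E" "p2 \<in> hom C D E" "p2 \<in> F" "p \<cdot> p1 = p \<cdot> p2"
    and ex: "\<And>T a b. a \<in> hom C T E \<Longrightarrow> b \<in> hom C T E \<Longrightarrow> p \<cdot> a = p \<cdot> b \<Longrightarrow>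
       \<exists>u \<in> hom C T D. p1 \<cdot> u = a \<and> p2 \<cdot> u = b"
    and un: "\<And>T u u'. u \<in> hom C T D \<Longrightarrow> u' \<in> hom C T D \<Longrightarrow> p1 \<cdot> u = p1 \<cdot> u' \<Longrightarrow> p2 \<cdot> u = p2 \<cdot> u' \<Longrightarrow> u = u'"
    using fibration_pullback[OF p(1) p(1) p(2)] by metis
  have p1F: "p1 \<in> F" by (rule F2_fib[OF is_pullback_sym[OF pb] p(2)])
  note E = hom_obj(1)[OF p(1)]
  obtain d where d: "d \<in> hom C E D" "p1 \<cdot> d = Id C E" "p2 \<cdot> d = Id C E"
    using ex[OF id_hom[OF E] id_hom[OF E]] by blast
  \<comment> \<open>\<open>D\<close> is the fibre product of \<open>E\<close> with itself over
    \<open>Y\<close>, and \<open>d\<close> is its diagonal.\<close>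
  obtain P c q where c: "c \<in> hom C E P" "q \<in> hom C P D" "c \<in> W" "q \<in> F" "q \<cdot> c = d"
    by (rule factorization[OF d(1)])
  \<comment> \<open>Each projection composed with \<open>q\<close> is a retraction of the weak
    equivalence \<open>c\<close>, hence a weak equivalence; it is a fibration as a composite of
    two.\<close>
  have triv: "x \<cdot> q \<in> hom C P E \<and> x \<cdot> q \<in> W \<inter> F"
    if x: "x \<in> hom C D E" "x \<in> F" "x \<cdot> d = Id C E" for x
  proof -
    have h: "x \<cdot> q \<in> hom C P E" by (rule comp_hom[OF c(2) x(1)])
    have "(x \<cdot> q) \<cdot> c = Id C E" using c x by (auto simp: hom_def)
    with W_cancel_right[OF c(3) _ c(1) h] id_W[OF E] have "x \<cdot> q \<in> W" by simp
    moreover have "x \<cdot> q \<in> F" using F1_comp[OF c(4) x(2)] c x by (auto simp: hom_def)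
    ultimately show ?thesis using h by blast
  qed
  show ?thesis
  proof (rule that[of "p1 \<cdot> q" P "p2 \<cdot> q"])
    show "p \<cdot> (p1 \<cdot> q) = p \<cdot> (p2 \<cdot> q)"
      by (rule comp_eq_precomp[OF D(1) p(1) D(2) p(1) D(4) c(2)])
  next
    fix A B f x y assume f: "f \<in> hom C A B" "f \<in> W" and x: "x \<in> hom C B E" and y: "y \<in> hom C B E"
      and pxy: "p \<cdot> x = p \<cdot> y" and xf: "x \<cdot> f = y \<cdot> f"
    from ex[OF x y pxy] obtain z where z: "z \<in> hom C B D" "p1 \<cdot> z = x" "p2 \<cdot> z = y" by blast
    have xfh: "x \<cdot> f \<in> hom C A E" by (rule comp_hom[OF f(1) x])
    \<comment> \<open>Since \<open>x\<close> and \<open>y\<close> agree after \<open>f\<close>, the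
      pair \<open>z\<close> restricts along \<open>f\<close> to the diagonal and thus factors
      through \<open>c\<close>. This is the square needed to lift \<open>z\<close> against
      \<open>q\<close>.\<close>
    have "q \<cdot> (c \<cdot> (x \<cdot> f)) = d \<cdot> (x \<cdot> f)"
      by (rule comp_eq_arr_precomp[OF c(1,2,5) xfh])
    also have "\<dots> = z \<cdot> f"
    proof (rule un[OF comp_hom[OF xfh d(1)] comp_hom[OF f(1) z(1)]])
      show "p1 \<cdot> (d \<cdot> (x \<cdot> f)) = p1 \<cdot> (z \<cdot> f)"
        using retraction_precomp[OF d(1) D(1) d(2) xfh] comp_eq_arr_precomp[OF z(1) D(1) z(2) f(1)]
        by simp
      show "p2 \<cdot> (d \<cdot> (x \<cdot> f)) = p2 \<cdot> (z \<cdot> f)"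
        using retraction_precomp[OF d(1) D(2) d(3) xfh] comp_eq_arr_precomp[OF z(1) D(2) z(3) f(1)] xf
        by simp
    qed
    finally have "q \<cdot> (c \<cdot> (x \<cdot> f)) = z \<cdot> f" .
    from weq_lift[OF f c(2,4) comp_hom[OF xfh c(1)] z(1) this]
    obtain h where h: "h \<in> hom C B P" "q \<cdot> h = z" .
    then show "\<exists>h \<in> hom C B P. (p1 \<cdot> q) \<cdot> h = x \<and> (p2 \<cdot> q) \<cdot> h = y"
      using z c D by (intro bexI[of _ h]) (auto simp: hom_def)
  qed (use triv[OF D(1) p1F d(2)] triv[OF D(2,3) d(3)] in auto)
qed

section \<open>Homotopies and retracts\<close>

lemma is_product_ex:
  assumes p: "is_product C X Y p1 p2" and "f \<in> hom C T X" "g \<in> hom C T Y"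
  shows "\<exists>u \<in> hom C T (Dom C p1). p1 \<cdot> u = f \<and> p2 \<cdot> u = g"
proof -
  have "\<exists>!u. is_pairing C p1 p2 f g u"
    using assms hom_obj(1)[OF assms(2)] unfolding is_product_def by blast
  then show ?thesis using assms(2) by (auto simp: is_pairing_def hom_def)
qed

lemma is_product_unique:
  assumes p: "is_product C X Y p1 p2" and u: "u \<in> hom C T (Dom C p1)" "u' \<in> hom C T (Dom C p1)"
    and e: "p1 \<cdot> u = p1 \<cdot> u'" "p2 \<cdot> u = p2 \<cdot> u'"
  shows "u = u'"
proof -
  have a: "p1 \<cdot> u \<in> hom C T X" "p2 \<cdot> u \<in> hom C T Y"
    using p u by (auto simp: is_product_def hom_def)
  then have "\<exists>!x. is_pairing C p1 p2 (p1 \<cdot> u) (p2 \<cdot> u) x"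
    using p hom_obj(1)[OF a(1)] unfolding is_product_def by blast
  moreover have "is_pairing C p1 p2 (p1 \<cdot> u) (p2 \<cdot> u) u" "is_pairing C p1 p2 (p1 \<cdot> u) (p2 \<cdot> u) u'"
    using a u e by (auto simp: is_pairing_def hom_def)
  ultimately show ?thesis by blast
qed

text \<open>The pullback of the fibration \<open>Y -> t\<close> along itself is a product, since any
  two parallel morphisms into \<open>t\<close> agree. Factoring its diagonal gives the path
  object.\<close>

lemma path_object:
  assumes Y: "Y \<in> Obj C"
  obtains p1 p2 d w q where "is_product C Y Y p1 p2" "is_pairing C p1 p2 (Id C Y) (Id C Y) d"
    "w \<in> W" "q \<in> F" "Cod C w = Dom C q" "q \<cdot> w = d"
proof -
  obtain f where f: "f \<in> hom C Y t" "f \<in> F"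
    using all_fibrant[OF Y] by (auto simp: final_fibrant_def)
  have tu: "g = g'" if "g \<in> hom C T t" "g' \<in> hom C T t" for g g' T
    using final that hom_obj(1)[OF that(1)] by (auto simp: is_final_def)
  obtain p1 p2 P where P: "p1 \<in> hom C P Y" "p2 \<in> hom C P Y"
    and ex: "\<And>T a b. a \<in> hom C T Y \<Longrightarrow> b \<in> hom C T Y \<Longrightarrow> f \<cdot> a = f \<cdot> b \<Longrightarrow>
       \<exists>u \<in> hom C T P. p1 \<cdot> u = a \<and> p2 \<cdot> u = b"
    and un: "\<And>T u u'. u \<in> hom C T P \<Longrightarrow> u' \<in> hom C T P \<Longrightarrow> p1 \<cdot> u = p1 \<cdot> u' \<Longrightarrow> p2 \<cdot> u = p2 \<cdot> u' \<Longrightarrow> u = u'"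
    using fibration_pullback[OF f(1) f(1) f(2)] by metis
  have prod: "is_product C Y Y p1 p2"
    unfolding is_product_def
  proof (intro conjI ballI)
    fix T a b assume "T \<in> Obj C" and a: "a \<in> hom C T Y" and b: "b \<in> hom C T Y"
    obtain u where u: "u \<in> hom C T P" "p1 \<cdot> u = a" "p2 \<cdot> u = b"
      using ex[OF a b tu[OF comp_hom[OF a f(1)] comp_hom[OF b f(1)]]] by blast
    show "\<exists>!u. is_pairing C p1 p2 a b u"
    proof (rule ex1I[of _ u])
      show "is_pairing C p1 p2 a b u" using u a P by (auto simp: is_pairing_def hom_def)
      show "x = u" if "is_pairing C p1 p2 a b x" for x
        using that u a P un[of x T u] by (auto simp: is_pairing_def hom_def)
    qed
  qed (use P in \<open>auto simp: hom_def\<close>)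
  from is_product_ex[OF prod id_hom[OF Y] id_hom[OF Y]]
  obtain d where d: "d \<in> hom C Y (Dom C p1)" "is_pairing C p1 p2 (Id C Y) (Id C Y) d"
    using id_arr[OF Y] by (auto simp: is_pairing_def)
  obtain D w q where "w \<in> hom C Y D" "q \<in> hom C D (Dom C p1)" "w \<in> W" "q \<in> F" "q \<cdot> w = d"
    by (rule factorization[OF d(1)])
  then show ?thesis using that[OF prod d(2)] by (auto simp: hom_def)
qed

text \<open>Precomposition with \<open>s\<close> acts on the homotopy \<open>h\<close> directly.
  Postcomposition with \<open>z\<close> requires a map from the path object of \<open>Y\<close> to
  one of \<open>Z\<close> over \<open>z \<times> z\<close>; it comes from lifting along the weak
  equivalence \<open>w\<close> against the fibration \<open>q'\<close>.\<close>

lemma homotopic_comp_comp: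
  assumes fg: "homotopic C t W F f g" and f: "f \<in> hom C X Y" and s: "s \<in> hom C X' X"
    and z: "z \<in> hom C Y Z"
  shows "homotopic C t W F (z \<cdot> (f \<cdot> s)) (z \<cdot> (g \<cdot> s))"
proof -
  obtain p1 p2 d w q h where g: "g \<in> hom C X Y"
    and P: "is_product C Y Y p1 p2" "is_pairing C p1 p2 (Id C Y) (Id C Y) d" "w \<in> W" "q \<in> F"
      "Cod C w = Dom C q" "q \<cdot> w = d" and h: "h \<in> hom C X (Dom C q)"
    and pair: "is_pairing C p1 p2 f g (q \<cdot> h)"
    using fg f unfolding homotopic_def by (auto simp: hom_def)
  note Z = hom_obj(2)[OF z] and Y = hom_obj(1)[OF z]
  obtain p1' p2' d' w' q' where P': "is_product C Z Z p1' p2'"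
    "is_pairing C p1' p2' (Id C Z) (Id C Z) d'" "w' \<in> W" "q' \<in> F" "Cod C w' = Dom C q'" "q' \<cdot> w' = d'"
    by (rule path_object[OF Z])
  have d: "d \<in> hom C Y (Dom C p1)" "p1 \<cdot> d = Id C Y" "p2 \<cdot> d = Id C Y"
    using P(2) Y by (auto simp: is_pairing_def)
  have d': "d' \<in> hom C Z (Dom C p1')" "p1' \<cdot> d' = Id C Z" "p2' \<cdot> d' = Id C Z"
    using P'(2) Z by (auto simp: is_pairing_def)
  have ps: "p1 \<in> hom C (Dom C p1) Y" "p2 \<in> hom C (Dom C p1) Y"
    "p1' \<in> hom C (Dom C p1') Z" "p2' \<in> hom C (Dom C p1') Z"
    using P(1) P'(1) by (auto simp: is_product_def hom_def)
  have arrs: "w \<in> Arr C" "q \<in> Arr C" "w' \<in> Arr C" "q' \<in> Arr C"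
    using P(3,4) P'(3,4) W_arr F_arr by auto
  have w: "w \<in> hom C Y (Dom C q)" and q: "q \<in> hom C (Dom C q) (Dom C p1)"
    using d(1) P(5,6) arrs by (auto simp: hom_def)
  have w': "w' \<in> hom C Z (Dom C q')" and q': "q' \<in> hom C (Dom C q') (Dom C p1')"
    using d'(1) P'(5,6) arrs by (auto simp: hom_def)
  \<comment> \<open>\<open>m\<close> is \<open>z \<times> z\<close> after \<open>q\<close>, given by
    its two components.\<close>
  obtain m where m: "m \<in> hom C (Dom C q) (Dom C p1')" "p1' \<cdot> m = z \<cdot> (p1 \<cdot> q)" "p2' \<cdot> m = z \<cdot> (p2 \<cdot> q)"
    using is_product_ex[OF P'(1) comp_hom[OF comp_hom[OF q ps(1)] z] comp_hom[OF comp_hom[OF q ps(2)] z]]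
    by blast
  \<comment> \<open>One projection at a time, \<open>d' \<cdot> z\<close> and
    \<open>m \<cdot> w\<close> both have component \<open>z\<close>.\<close>
  have aux: "x' \<cdot> (d' \<cdot> z) = x' \<cdot> (m \<cdot> w)"
    if "x' \<in> hom C (Dom C p1') Z" "x' \<cdot> d' = Id C Z" "x \<in> hom C (Dom C p1) Y" "x \<cdot> d = Id C Y"
      "x' \<cdot> m = z \<cdot> (x \<cdot> q)" for x x'
  proof -
    have "x' \<cdot> (d' \<cdot> z) = z" by (rule retraction_precomp[OF d'(1) that(1,2) z])
    moreover have "x' \<cdot> (m \<cdot> w) = (z \<cdot> (x \<cdot> q)) \<cdot> w"
      by (rule comp_eq_arr_precomp[OF m(1) that(1,5) w])
    moreover have "\<dots> = z \<cdot> (x \<cdot> (q \<cdot> w))" using z that q w by (auto simp: hom_def)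
    ultimately show ?thesis using P(6) that(4) comp_id_right[OF z] by simp
  qed
  have "q' \<cdot> (w' \<cdot> z) = d' \<cdot> z" by (rule comp_eq_arr_precomp[OF w' q' P'(6) z])
  also have "\<dots> = m \<cdot> w"
    using is_product_unique[OF P'(1) comp_hom[OF z d'(1)] comp_hom[OF w m(1)]]
      aux[OF ps(3) d'(2) ps(1) d(2) m(2)] aux[OF ps(4) d'(3) ps(2) d(3) m(3)] by blast
  finally have "q' \<cdot> (w' \<cdot> z) = m \<cdot> w" .
  from weq_lift[OF w P(3) q' P'(4) comp_hom[OF z w'] m(1) this]
  obtain k where k: "k \<in> hom C (Dom C q) (Dom C q')" "q' \<cdot> k = m" .
  let ?h = "k \<cdot> (h \<cdot> s)"
  have hs: "h \<cdot> s \<in> hom C X' (Dom C q)" by (rule comp_hom[OF s h])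
  have hh: "?h \<in> hom C X' (Dom C q')" by (rule comp_hom[OF hs k(1)])
  have qh: "q' \<cdot> ?h = m \<cdot> (h \<cdot> s)" by (rule comp_eq_arr_precomp[OF k(1) q' k(2) hs])
  \<comment> \<open>The two ends of the new homotopy, again one projection at a time.\<close>
  have ends: "x' \<cdot> (m \<cdot> (h \<cdot> s)) = z \<cdot> (y \<cdot> s)"
    if "x' \<in> hom C (Dom C p1') Z" "x \<in> hom C (Dom C p1) Y" "x' \<cdot> m = z \<cdot> (x \<cdot> q)"
      "x \<cdot> (q \<cdot> h) = y" for x x' y
  proof -
    have "x' \<cdot> (m \<cdot> (h \<cdot> s)) = (z \<cdot> (x \<cdot> q)) \<cdot> (h \<cdot> s)"
      by (rule comp_eq_arr_precomp[OF m(1) that(1,3) hs])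
    also have "\<dots> = z \<cdot> ((x \<cdot> (q \<cdot> h)) \<cdot> s)" using z that(1,2) q h s by (auto simp: hom_def)
    finally show ?thesis using that(4) by simp
  qed
  have "is_pairing C p1' p2' (z \<cdot> (f \<cdot> s)) (z \<cdot> (g \<cdot> s)) (q' \<cdot> ?h)"
    using ends[OF ps(3,1) m(2)] ends[OF ps(4,2) m(3)] pair comp_hom[OF hs m(1)] s f z
    unfolding is_pairing_def qh by (auto simp: hom_def)
  moreover have "z \<cdot> (f \<cdot> s) \<in> hom C X' Z" "z \<cdot> (g \<cdot> s) \<in> hom C X' Z"
    using comp_hom s f g z by blast+
  ultimately show ?thesis
    unfolding homotopic_def
    using all_cofibrant[OF hom_obj(1)[OF s]] all_fibrant[OF Z] P' hh by blast
qed

text \<open>If \<open>k\<close> is a homotopy inverse of \<open>s \<cdot> q\<close>, then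
  \<open>k \<cdot> s\<close> is one of \<open>q\<close>: inserting \<open>r \<cdot> s\<close> in
  front of \<open>q \<cdot> (k \<cdot> s)\<close> gives
  \<open>r \<cdot> (s \<cdot> q \<cdot> k) \<cdot> s\<close>, which is homotopic to
  \<open>r \<cdot> s\<close>. This is where weak equivalences being the homotopy equivalences
  enters.\<close>

lemma W_retract:
  assumes q: "q \<in> hom C X D" and s: "s \<in> hom C D Z" and r: "r \<in> hom C Z D"
    and rs: "r \<cdot> s = Id C D" and W: "s \<cdot> q \<in> W"
  shows "q \<in> W"
proof -
  have sq: "s \<cdot> q \<in> hom C X Z" by (rule comp_hom[OF q s])
  obtain k where k: "k \<in> hom C Z X" and h1: "homotopic C t W F (k \<cdot> (s \<cdot> q)) (Id C X)"
    and h2: "homotopic C t W F ((s \<cdot> q) \<cdot> k) (Id C Z)"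
    using W W_iff[of "s \<cdot> q"] sq by (auto simp: homotopy_equivalence_def hom_def)
  have ks: "k \<cdot> s \<in> hom C D X" by (rule comp_hom[OF s k])
  have e: "r \<cdot> (((s \<cdot> q) \<cdot> k) \<cdot> s) = q \<cdot> (k \<cdot> s)"
    using retraction_precomp[OF s r rs comp_hom[OF ks q]] q s k by (auto simp: hom_def)
  have "homotopic C t W F (r \<cdot> (((s \<cdot> q) \<cdot> k) \<cdot> s)) (r \<cdot> (Id C Z \<cdot> s))"
    by (rule homotopic_comp_comp[OF h2 comp_hom[OF k sq] s r])
  then have "homotopic C t W F (q \<cdot> (k \<cdot> s)) (Id C D)"
    unfolding e using comp_id_left[OF s] rs by simp
  moreover have "homotopic C t W F ((k \<cdot> s) \<cdot> q) (Id C X)"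
    using h1 q s k by (simp add: hom_def)
  ultimately show ?thesis
    using W_iff[of q] q ks by (auto simp: homotopy_equivalence_def hom_def)
qed

text \<open>Retract argument: lifting \<open>i\<close> against the fibration of its own
  factorization gives a section of that fibration which carries \<open>i\<close> to the weak
  equivalence \<open>w\<close>.\<close>

lemma llp_fibrations_W:
  assumes i: "i \<in> hom C A B" and l: "\<And>p. p \<in> F \<Longrightarrow> has_llp C i p"
  shows "i \<in> W"
proof -
  obtain P w p where w: "w \<in> hom C A P" "p \<in> hom C P B" "w \<in> W" "p \<in> F" "p \<cdot> w = i"
    by (rule factorization[OF i])
  have "p \<cdot> w = Id C B \<cdot> i" using w comp_id_left[OF i] by simp
  from has_llpD[OF l[OF w(4)] i w(2,1) id_hom[OF hom_obj(2)[OF i]] this]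
  obtain h where "h \<in> hom C B P" "h \<cdot> i = w" "p \<cdot> h = Id C B" .
  with W_retract[OF i _ w(2)] w(3) show ?thesis by metis
qed

section \<open>Cobase change of trivial cofibrations, and left properness\<close>

lemma triv_cof_pushout:
  assumes po: "is_pushout C f g p q" and f: "f \<in> W \<inter> cofibrations C W F"
  shows "q \<in> W \<inter> cofibrations C W F"
proof -
  have q: "q \<in> Arr C" using po by (simp add: is_pushout_def)
  have l: "has_llp C q x" if "x \<in> F" for x
    using llp_pushout[OF po _ triv_cof_lift[OF _ _ that]] F_arr that f by blast
  from llp_fibrations_W[OF arr_hom[OF q] l] l q show ?thesis by (auto simp: cofibrations_def)
qed

lemma cof_pushout:
  assumes po: "is_pushout C f g p q" and f: "f \<in> cofibrations C W F"
  shows "q \<in> cofibrations C W F"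
  using llp_pushout[OF po] po f F_arr by (auto simp: cofibrations_def is_pushout_def)

text \<open>If a lift \<open>h\<close> of \<open>p\<close> through \<open>r\<close> agreed with
  \<open>w\<close> strictly on \<open>A\<close>, the two would glue to a section of
  \<open>r\<close>. It agrees only up to a homotopy over \<open>D\<close>, so \<open>w\<close> is
  first deformed along \<open>g\<close> until the agreement is strict.\<close>

lemma W_pushout_along_cof:
  assumes po: "is_pushout C f g p q" and fW: "f \<in> W" and gK: "g \<in> cofibrations C W F"
  shows "q \<in> W"
proof -
  define A B X where "A = Dom C f" "B = Cod C f" "X = Cod C g"
  have f: "f \<in> hom C A B" and g: "g \<in> hom C A X"
    using po by (auto simp: is_pushout_def hom_def A_B_X_def)
  from is_pushoutD[OF po f g] obtain D where p: "p \<in> hom C B D" and q: "q \<in> hom C X D"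
    and e: "p \<cdot> f = q \<cdot> g"
    and ex: "\<And>T a b. a \<in> hom C B T \<Longrightarrow> b \<in> hom C X T \<Longrightarrow> a \<cdot> f = b \<cdot> g \<Longrightarrow>
       \<exists>u \<in> hom C D T. u \<cdot> p = a \<and> u \<cdot> q = b"
    and un: "\<And>T u u'. u \<in> hom C D T \<Longrightarrow> u' \<in> hom C D T \<Longrightarrow> u \<cdot> p = u' \<cdot> p \<Longrightarrow> u \<cdot> q = u' \<cdot> q \<Longrightarrow> u = u'"
    by metis
  obtain Z w r where w: "w \<in> hom C X Z" "w \<in> W" and r: "r \<in> hom C Z D" "r \<in> F" and rw: "r \<cdot> w = q"
    by (rule factorization[OF q])
  have "r \<cdot> (w \<cdot> g) = p \<cdot> f" using comp_eq_arr_precomp[OF w(1) r(1) rw g] e by simp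
  from triv_fib_replacement[OF f fW r comp_hom[OF g w(1)] p this] obtain Q m j k
    where m: "m \<in> hom C Q B" "m \<in> W \<inter> F" and j: "j \<in> hom C A Q" and k: "k \<in> hom C Q Z"
      and rk: "r \<cdot> k = p \<cdot> m" and kj: "k \<cdot> j = w \<cdot> g" and mj: "m \<cdot> j = f" by metis
  obtain s where s: "s \<in> hom C B Q" "m \<cdot> s = Id C B" by (rule triv_fib_section[OF m])
  note B = hom_obj(1)[OF s(1)]
  have sW: "s \<in> W" using W_cancel_left[OF _ _ s(1) m(1)] m(2) s(2) id_W[OF B] by auto
  \<comment> \<open>\<open>h\<close> lifts \<open>p\<close> through \<open>r\<close>; the homotopy
    \<open>H\<close> below compares \<open>h \<cdot> f\<close> with
    \<open>w \<cdot> g\<close>.\<close>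
  define h where "h = k \<cdot> s"
  have h: "h \<in> hom C B Z" unfolding h_def by (rule comp_hom[OF s(1) k])
  have rh: "r \<cdot> h = p"
    using comp_eq_precomp[OF k r(1) m(1) p rk s(1)] s(2) comp_id_right[OF p] by (simp add: h_def)
  obtain P a b where a: "a \<in> hom C P Z" "b \<in> hom C P Z" "a \<in> W \<inter> F" "b \<in> W \<inter> F" and rab: "r \<cdot> a = r \<cdot> b"
    and pathlift: "\<And>A B f x y. f \<in> hom C A B \<Longrightarrow> f \<in> W \<Longrightarrow> x \<in> hom C B Z \<Longrightarrow> y \<in> hom C B Z \<Longrightarrow>
       r \<cdot> x = r \<cdot> y \<Longrightarrow> x \<cdot> f = y \<cdot> f \<Longrightarrow> \<exists>h \<in> hom C B P. a \<cdot> h = x \<and> b \<cdot> h = y"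
    by (rule relative_path_object[OF r]) blast
  \<comment> \<open>\<open>h \<cdot> m\<close> and \<open>k\<close> agree over \<open>D\<close> and
    also after \<open>s\<close>, a weak equivalence as a section of \<open>m\<close>. The path
    object therefore supplies a homotopy \<open>th\<close> between them, which restricts along
    \<open>j\<close> to \<open>H\<close>.\<close>
  have "r \<cdot> (h \<cdot> m) = r \<cdot> k" using comp_eq_arr_precomp[OF h r(1) rh m(1)] rk by simp
  moreover have "(h \<cdot> m) \<cdot> s = k \<cdot> s"
    using h m(1) s comp_id_right[OF h] by (auto simp: hom_def h_def)
  ultimately obtain th where th: "th \<in> hom C Q P" "a \<cdot> th = h \<cdot> m" "b \<cdot> th = k"
    using pathlift[OF s(1) sW comp_hom[OF m(1) h] k] by blast
  define H where "H = th \<cdot> j"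
  have H: "H \<in> hom C A P" unfolding H_def by (rule comp_hom[OF j th(1)])
  have aH: "a \<cdot> H = h \<cdot> f"
    unfolding H_def using comp_eq_precomp[OF th(1) a(1) m(1) h th(2) j] mj by simp
  have bH: "b \<cdot> H = w \<cdot> g"
    unfolding H_def using comp_eq_arr_precomp[OF th(1) a(2) th(3) j] kj by simp
  \<comment> \<open>homotopy extension: move \<open>w\<close> to a homotopic \<open>a \<cdot> G\<close> agreeing with \<open>h\<close> on \<open>A\<close>\<close>
  have "has_llp C g b" using gK a(4) by (auto simp: cofibrations_def)
  from has_llpD[OF this g a(2) H w(1) bH]
  obtain G where G: "G \<in> hom C X P" "G \<cdot> g = H" "b \<cdot> G = w" .
  \<comment> \<open>\<open>a\<close> and \<open>b\<close> are weak equivalences, so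
    \<open>a \<cdot> G\<close> is one because \<open>w = b \<cdot> G\<close> is.\<close>
  have GW: "G \<in> W" using W_cancel_left[OF _ _ G(1) a(2)] a(4) G(3) w(2) by auto
  have aG: "a \<cdot> G \<in> hom C X Z" "a \<cdot> G \<in> W"
    using comp_hom[OF G(1) a(1)] W_comp[OF GW _ G(1) a(1)] a(3) by auto
  \<comment> \<open>Now \<open>a \<cdot> G\<close> and \<open>h\<close> agree strictly on
    \<open>A\<close> and glue to \<open>\<sigma>\<close>. As \<open>a\<close> and \<open>b\<close>
    coincide over \<open>D\<close>, it is a section of \<open>r\<close>, and
    \<open>W_retract\<close> applies.\<close>
  have "(a \<cdot> G) \<cdot> g = h \<cdot> f" using a(1) G(1,2) g aH by (auto simp: hom_def)
  with ex[OF h aG(1)] obtain \<sigma> where \<sigma>: "\<sigma> \<in> hom C D Z" "\<sigma> \<cdot> p = h" "\<sigma> \<cdot> q = a \<cdot> G" by metis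
  have raG: "r \<cdot> (a \<cdot> G) = q"
    using comp_eq_precomp[OF a(1) r(1) a(2) r(1) rab G(1)] G(3) rw by simp
  have "r \<cdot> \<sigma> = Id C D"
  proof (rule un[OF comp_hom[OF \<sigma>(1) r(1)] id_hom[OF hom_obj(2)[OF p]]])
    show "(r \<cdot> \<sigma>) \<cdot> p = Id C D \<cdot> p" "(r \<cdot> \<sigma>) \<cdot> q = Id C D \<cdot> q"
      using \<sigma> r(1) p q rh raG by (auto simp: hom_def)
  qed
  from W_retract[OF q \<sigma>(1) r(1) this] \<sigma>(3) aG(2) show ?thesis by simp
qed

section \<open>Closure properties of cofibrations and fibrancy of all objects\<close>

lemma cof_iso:
  assumes "is_iso C f"
  shows "f \<in> W \<inter> cofibrations C W F"
  using assms F1_iso llp_iso F_arr by (auto simp: cofibrations_def is_iso_def)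

lemma cof_comp:
  assumes "f \<in> cofibrations C W F" "g \<in> cofibrations C W F" "f \<in> hom C X Y" "g \<in> hom C Y Z"
  shows "g \<cdot> f \<in> cofibrations C W F"
  using assms llp_comp[OF assms(3,4)] comp_hom[OF assms(3,4)] F_arr
  by (auto simp: cofibrations_def hom_def)

text \<open>The base change of \<open>p\<close> along \<open>v\<close> is a trivial fibration over
  the cofibrant object \<open>X\<close>, so it has a section.\<close>

lemma triv_fib_lift:
  assumes p: "p \<in> hom C E Y" "p \<in> W \<inter> F" and v: "v \<in> hom C X Y"
  obtains h where "h \<in> hom C X E" "p \<cdot> h = v"
proof -
  obtain p' q' P where pb: "is_pullback C p v p' q'" and P: "p' \<in> hom C P E" "q' \<in> hom C P X"
      "p \<cdot> p' = v \<cdot> q'"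
    using fibration_pullback[OF p(1) v] p(2) by (metis IntD2)
  obtain s where s: "s \<in> hom C X P" "q' \<cdot> s = Id C X"
    by (rule triv_fib_section[OF P(2) F2_triv[OF pb p(2)]])
  have "p \<cdot> (p' \<cdot> s) = v"
    using comp_eq_precomp[OF P(1) p(1) P(2) v P(3) s(1)] s(2) comp_id_right[OF v] by simp
  with comp_hom[OF s(1) P(1)] show ?thesis using that by blast
qed

text \<open>A retraction of \<open>i\<close> is a lift of the identity against the fibration
  \<open>X -> t\<close>; the square commutes because \<open>t\<close> is final.\<close>

lemma all_cof_fibrant:
  assumes X: "X \<in> Obj C"
  shows "fibrant C W (cofibrations C W F) X"
  unfolding fibrant_def
proof (intro conjI ballI impI X)
  fix i assume i: "i \<in> W \<inter> cofibrations C W F" and "Dom C i = X"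
  then have ih: "i \<in> hom C X (Cod C i)" by (auto simp: cofibrations_def hom_def)
  obtain x where x: "x \<in> hom C X t" "x \<in> F"
    using all_fibrant[OF X] by (auto simp: final_fibrant_def)
  obtain v where v: "v \<in> hom C (Cod C i) t"
    using final hom_obj(2)[OF ih] unfolding is_final_def by blast
  have "x \<cdot> Id C X = v \<cdot> i"
    using final X comp_id_right[OF x(1)] x(1) comp_hom[OF ih v] by (auto simp: is_final_def)
  from has_llpD[OF triv_cof_lift[OF _ _ x(2)] ih x(1) id_hom[OF X] v this] i
  show "\<exists>r \<in> hom C (Cod C i) X. r \<cdot> i = Id C X" by blast
qed

end


section \<open>Mapping cylinders\<close>

text \<open>\<open>cylinders\<close> ranges over every choice of coproduct, so it applies to the one
  constructed as a pushout over \<open>e\<close>.\<close>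

locale cylinder_fibration_category = bifibrant_fibration_category C t W F
  for C :: "('o, 'm, 'z) cat_scheme" (structure) and t :: 'o and W F :: "'m set" +
  fixes e :: 'o
  assumes initial: "is_initial C e"
    and pushouts: "f \<in> Arr C \<Longrightarrow> g \<in> Arr C \<Longrightarrow> Dom C f = Dom C g \<Longrightarrow>
          f \<in> cofibrations C W F \<or> g \<in> cofibrations C W F \<Longrightarrow> \<exists>p q. is_pushout C f g p q"
    and cylinders: "X \<in> Obj C \<Longrightarrow> is_coproduct C X X i1 i2 \<Longrightarrow>
          is_copairing C i1 i2 (Id C X) (Id C X) d \<Longrightarrow>
          \<exists>i \<in> cofibrations C W F. \<exists>w \<in> W. Cod C i = Dom C w \<and> w \<cdot> i = d"
begin

lemma initial_unique: "f \<in> hom C e X \<Longrightarrow> g \<in> hom C e X \<Longrightarrow> f = g"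
  using initial hom_obj(2)[of f e X] by (auto simp: is_initial_def)

text \<open>The lower triangle comes from \<open>triv_fib_lift\<close>; the upper one commutes by
  initiality.\<close>

lemma initial_cof:
  assumes x: "x \<in> hom C e X"
  shows "x \<in> cofibrations C W F"
proof -
  have "has_llp C x p" if p: "p \<in> W \<inter> F" for p
  proof -
    have ph: "p \<in> hom C (Dom C p) (Cod C p)" using p F_arr arr_hom by blast
    show ?thesis
    proof (rule has_llpI[OF x ph])
      fix u v assume u: "u \<in> hom C e (Dom C p)" and v: "v \<in> hom C X (Cod C p)"
      obtain h where "h \<in> hom C X (Dom C p)" "p \<cdot> h = v" by (rule triv_fib_lift[OF ph p v])
      with initial_unique[OF comp_hom[OF x] u]
      show "\<exists>h \<in> hom C X (Dom C p). h \<cdot> x = u \<and> p \<cdot> h = v" by blast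
    qed
  qed
  with x show ?thesis by (auto simp: cofibrations_def hom_def)
qed

lemma all_initial_cofibrant:
  assumes "X \<in> Obj C"
  shows "initial_cofibrant C e (cofibrations C W F) X"
  using assms initial initial_cof unfolding initial_cofibrant_def is_initial_def by blast

text \<open>The last property is the lifting property of the cofibration from the coproduct into the
  cylinder, expressed through the two ends so that the coproduct disappears. \<open>i0\<close> is a
  weak equivalence as a section of \<open>w\<close>.\<close>

lemma cylinder_object:
  assumes X: "X \<in> Obj C"
  obtains Y i0 i1 w where "i0 \<in> hom C X Y" "i1 \<in> hom C X Y" "w \<in> hom C Y X"
    "i0 \<in> W \<inter> cofibrations C W F" "w \<in> W" "w \<cdot> i0 = Id C X" "w \<cdot> i1 = Id C X"
    "\<And>E B p a b v. p \<in> hom C E B \<Longrightarrow> p \<in> W \<inter> F \<Longrightarrow> a \<in> hom C X E \<Longrightarrow> b \<in> hom C X E \<Longrightarrow>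
       v \<in> hom C Y B \<Longrightarrow> p \<cdot> a = v \<cdot> i0 \<Longrightarrow> p \<cdot> b = v \<cdot> i1 \<Longrightarrow>
       \<exists>k \<in> hom C Y E. k \<cdot> i0 = a \<and> k \<cdot> i1 = b \<and> p \<cdot> k = v"
proof -
  obtain x where x: "x \<in> hom C e X" using initial X unfolding is_initial_def by blast
  note xK = initial_cof[OF x]
  obtain j0 j1 where po: "is_pushout C x x j0 j1" using pushouts[of x x] x xK by (auto simp: hom_def)
  from is_pushoutD[OF po x x] obtain D where j: "j0 \<in> hom C X D" "j1 \<in> hom C X D"
    and ex: "\<And>T a b. a \<in> hom C X T \<Longrightarrow> b \<in> hom C X T \<Longrightarrow> a \<cdot> x = b \<cdot> x \<Longrightarrow>
       \<exists>u \<in> hom C D T. u \<cdot> j0 = a \<and> u \<cdot> j1 = b"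
    and un: "\<And>T u u'. u \<in> hom C D T \<Longrightarrow> u' \<in> hom C D T \<Longrightarrow> u \<cdot> j0 = u' \<cdot> j0 \<Longrightarrow> u \<cdot> j1 = u' \<cdot> j1 \<Longrightarrow> u = u'"
    by metis
  have ex': "\<exists>u \<in> hom C D T. u \<cdot> j0 = a \<and> u \<cdot> j1 = b" if "a \<in> hom C X T" "b \<in> hom C X T" for T a b
    by (rule ex[OF that initial_unique[OF comp_hom[OF x that(1)] comp_hom[OF x that(2)]]])
  have coprod: "is_coproduct C X X j0 j1"
    unfolding is_coproduct_def
  proof (intro conjI ballI)
    fix T a b assume a: "a \<in> hom C X T" and b: "b \<in> hom C X T"
    obtain u where u: "u \<in> hom C D T" "u \<cdot> j0 = a" "u \<cdot> j1 = b" using ex'[OF a b] by blast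
    show "\<exists>!u. is_copairing C j0 j1 a b u"
    proof (rule ex1I[of _ u])
      show "is_copairing C j0 j1 a b u" using u a j by (auto simp: is_copairing_def hom_def)
      show "y = u" if "is_copairing C j0 j1 a b y" for y
        using that u a j un[of y T u] by (auto simp: is_copairing_def hom_def)
    qed
  qed (use j in \<open>auto simp: hom_def\<close>)
  \<comment> \<open>In the given square the cobase change of the first \<open>x\<close> is
    \<open>j1\<close>; the transposed square gives \<open>j0\<close>.\<close>
  have j0K: "j0 \<in> cofibrations C W F"
  proof -
    have "is_pushout C x x j1 j0"
      using po unfolding is_pushout_def by (auto; metis)
    from cof_pushout[OF this xK] show ?thesis .
  qed
  obtain d where d: "d \<in> hom C D X" "d \<cdot> j0 = Id C X" "d \<cdot> j1 = Id C X"
    using ex'[OF id_hom[OF X] id_hom[OF X]] by blast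
  have "is_copairing C j0 j1 (Id C X) (Id C X) d"
    using d j X by (auto simp: is_copairing_def hom_def)
  from cylinders[OF X coprod this] obtain i w where i: "i \<in> cofibrations C W F" "w \<in> W"
    "Cod C i = Dom C w" "w \<cdot> i = d" by blast
  have "w \<in> Arr C" "i \<in> Arr C" using i W_arr by (auto simp: cofibrations_def)
  then have ih: "i \<in> hom C D (Dom C w)" and wh: "w \<in> hom C (Dom C w) X"
    using i d(1) by (auto simp: hom_def)
  let ?i0 = "i \<cdot> j0" and ?i1 = "i \<cdot> j1"
  have h0: "?i0 \<in> hom C X (Dom C w)" and h1: "?i1 \<in> hom C X (Dom C w)"
    using comp_hom[OF _ ih] j by auto
  have w0: "w \<cdot> ?i0 = Id C X" and w1: "w \<cdot> ?i1 = Id C X"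
    using comp_eq_arr_precomp[OF ih wh i(4)] j d by auto
  have "?i0 \<in> W" using W_cancel_left[OF i(2) _ h0 wh] w0 id_W[OF X] by simp
  moreover have "?i0 \<in> cofibrations C W F" by (rule cof_comp[OF j0K i(1) j(1) ih])
  moreover have "\<exists>k \<in> hom C (Dom C w) E. k \<cdot> ?i0 = a \<and> k \<cdot> ?i1 = b \<and> p \<cdot> k = v"
    if p: "p \<in> hom C E B" "p \<in> W \<inter> F" and a: "a \<in> hom C X E" and b: "b \<in> hom C X E"
      and v: "v \<in> hom C (Dom C w) B" and ea: "p \<cdot> a = v \<cdot> ?i0" and eb: "p \<cdot> b = v \<cdot> ?i1"
    for E B p a b v
  proof -
    obtain u where u: "u \<in> hom C D E" "u \<cdot> j0 = a" "u \<cdot> j1 = b" using ex'[OF a b] by blast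
    have "p \<cdot> u = v \<cdot> i"
    proof (rule un[OF comp_hom[OF u(1) p(1)] comp_hom[OF ih v]])
      show "(p \<cdot> u) \<cdot> j0 = (v \<cdot> i) \<cdot> j0" "(p \<cdot> u) \<cdot> j1 = (v \<cdot> i) \<cdot> j1"
        using u p(1) j ih v ea eb by (auto simp: hom_def)
    qed
    moreover have "has_llp C i p" using i(1) p(2) by (auto simp: cofibrations_def)
    ultimately obtain k where k: "k \<in> hom C (Dom C w) E" "k \<cdot> i = u" "p \<cdot> k = v"
      using has_llpD[OF _ ih p(1) u(1) v] by metis
    then have "k \<cdot> ?i0 = a" "k \<cdot> ?i1 = b"
      using comp_eq_arr_precomp[OF ih k(1,2)] j u by auto
    with k show ?thesis by blast
  qed
  ultimately show ?thesis using that[OF h0 h1 wh _ i(2) w0 w1] by blast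
qed

text \<open>Gluing the end \<open>i0\<close> of the cylinder to \<open>Y\<close> along
  \<open>f\<close> gives \<open>M\<close>. The free end \<open>c \<cdot> i1\<close> is the
  cofibration, and the collapse \<open>r\<close> is a weak equivalence because it retracts
  \<open>j\<close>, a cobase change of a trivial cofibration.\<close>

lemma mapping_cylinder:
  assumes fA: "f \<in> Arr C"
  shows "\<exists>i \<in> cofibrations C W F. \<exists>w \<in> W. Cod C i = Dom C w \<and> w \<cdot> i = f"
proof -
  define X Y where "X = Dom C f" "Y = Cod C f"
  have f: "f \<in> hom C X Y" using fA by (auto simp: hom_def X_Y_def)
  note X = hom_obj(1)[OF f] and Y = hom_obj(2)[OF f]
  obtain I i0 i1 w where i0: "i0 \<in> hom C X I" and i1: "i1 \<in> hom C X I" and w: "w \<in> hom C I X"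
    and i0K: "i0 \<in> W \<inter> cofibrations C W F" and w01: "w \<cdot> i0 = Id C X" "w \<cdot> i1 = Id C X"
    and cyl: "\<And>E B p a b v. p \<in> hom C E B \<Longrightarrow> p \<in> W \<inter> F \<Longrightarrow> a \<in> hom C X E \<Longrightarrow> b \<in> hom C X E \<Longrightarrow>
       v \<in> hom C I B \<Longrightarrow> p \<cdot> a = v \<cdot> i0 \<Longrightarrow> p \<cdot> b = v \<cdot> i1 \<Longrightarrow>
       \<exists>k \<in> hom C I E. k \<cdot> i0 = a \<and> k \<cdot> i1 = b \<and> p \<cdot> k = v"
    by (rule cylinder_object[OF X]) blast
  obtain c j where po: "is_pushout C i0 f c j"
    using pushouts[of i0 f] i0 f i0K by (auto simp: hom_def)
  from is_pushoutD[OF po i0 f] obtain M where c: "c \<in> hom C I M" and j: "j \<in> hom C Y M"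
    and cj: "c \<cdot> i0 = j \<cdot> f"
    and ex: "\<And>T a b. a \<in> hom C I T \<Longrightarrow> b \<in> hom C Y T \<Longrightarrow> a \<cdot> i0 = b \<cdot> f \<Longrightarrow>
       \<exists>u \<in> hom C M T. u \<cdot> c = a \<and> u \<cdot> j = b"
    and un: "\<And>T u u'. u \<in> hom C M T \<Longrightarrow> u' \<in> hom C M T \<Longrightarrow> u \<cdot> c = u' \<cdot> c \<Longrightarrow> u \<cdot> j = u' \<cdot> j \<Longrightarrow> u = u'"
    by metis
  have jW: "j \<in> W" using triv_cof_pushout[OF po i0K] by blast
  have "(f \<cdot> w) \<cdot> i0 = Id C Y \<cdot> f" using f w i0 w01 by (auto simp: hom_def)
  from ex[OF comp_hom[OF w f] id_hom[OF Y] this]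
  obtain r where r: "r \<in> hom C M Y" "r \<cdot> c = f \<cdot> w" "r \<cdot> j = Id C Y" by blast
  have rW: "r \<in> W" using W_cancel_right[OF jW _ j r(1)] r(3) id_W[OF Y] by simp
  have ch: "c \<cdot> i1 \<in> hom C X M" by (rule comp_hom[OF i1 c])
  have rc: "r \<cdot> (c \<cdot> i1) = f"
    using comp_eq_precomp[OF c r(1) w f r(2) i1] w01(2) comp_id_right[OF f] by simp
  have "has_llp C (c \<cdot> i1) p" if p: "p \<in> W \<inter> F" for p
  proof -
    have ph: "p \<in> hom C (Dom C p) (Cod C p)" using p F_arr arr_hom by blast
    show ?thesis
    proof (rule has_llpI[OF ch ph])
      fix a b assume a: "a \<in> hom C X (Dom C p)" and b: "b \<in> hom C M (Cod C p)"
        and e: "p \<cdot> a = b \<cdot> (c \<cdot> i1)"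
      \<comment> \<open>The lift is built in stages: on \<open>Y\<close>, then on the cylinder with
        the prescribed ends \<open>y \<cdot> f\<close> and \<open>a\<close>, then glued over
        \<open>M\<close>.\<close>
      obtain y where y: "y \<in> hom C Y (Dom C p)" "p \<cdot> y = b \<cdot> j"
        by (rule triv_fib_lift[OF ph p comp_hom[OF j b]])
      have "p \<cdot> (y \<cdot> f) = (b \<cdot> c) \<cdot> i0"
        using comp_eq_precomp[OF y(1) ph j b y(2) f] cj b c i0 by (auto simp: hom_def)
      moreover have "p \<cdot> a = (b \<cdot> c) \<cdot> i1" using e b c i1 by (auto simp: hom_def)
      ultimately obtain k where k: "k \<in> hom C I (Dom C p)" "k \<cdot> i0 = y \<cdot> f" "k \<cdot> i1 = a" "p \<cdot> k = b \<cdot> c"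
        using cyl[OF ph p comp_hom[OF f y(1)] a comp_hom[OF c b]] by blast
      from ex[OF k(1) y(1) k(2)] obtain l where l: "l \<in> hom C M (Dom C p)" "l \<cdot> c = k" "l \<cdot> j = y"
        by blast
      have "p \<cdot> l = b"
      proof (rule un[OF comp_hom[OF l(1) ph] b])
        show "(p \<cdot> l) \<cdot> c = b \<cdot> c" "(p \<cdot> l) \<cdot> j = b \<cdot> j"
          using l ph c j k(4) y(2) by (auto simp: hom_def)
      qed
      moreover have "l \<cdot> (c \<cdot> i1) = a" using comp_eq_arr_precomp[OF c l(1,2) i1] k(3) by simp
      ultimately show "\<exists>h \<in> hom C M (Dom C p). h \<cdot> (c \<cdot> i1) = a \<and> p \<cdot> h = b"
        using l(1) by blast
    qed
  qed
  then have "c \<cdot> i1 \<in> cofibrations C W F" using ch by (auto simp: cofibrations_def hom_def)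
  moreover have "Cod C (c \<cdot> i1) = Dom C r" using ch r(1) by (simp add: hom_def)
  ultimately show ?thesis using rW rc by blast
qed

lemma is_cofibration_category: "cofibration_category C e W (cofibrations C W F)"
proof (intro cofibration_category.intro cofibration_category_axioms.intro)
  show "cofibrations C W F \<subseteq> Arr C" by (auto simp: cofibrations_def)
  show "g \<cdot> f \<in> cofibrations C W F"
    if "f \<in> cofibrations C W F" "g \<in> cofibrations C W F" "Cod C f = Dom C g" for f g
    using that cof_comp[of f g "Dom C f" "Cod C f" "Cod C g"] by (auto simp: cofibrations_def hom_def)
  \<comment> \<open>Every object is already fibrant, so the identity serves.\<close>
  show "\<exists>i \<in> W \<inter> cofibrations C W F. Dom C i = X \<and> fibrant C W (cofibrations C W F) (Cod C i)"
    if "X \<in> Obj C" for X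
    using cof_iso[OF id_iso[OF that]] id_arr[OF that] all_cof_fibrant[OF that] by auto
qed (fact category_axioms initial W_arr cof_iso F1_two_of_three pushouts cof_pushout
    triv_cof_pushout W_pushout_along_cof mapping_cylinder)+

end


theorem theorem6p8:
  fixes C :: "('o, 'm, 'z) cat_scheme" and t e :: 'o and W F :: "'m set"
  assumes "fibration_category C t W F"
    and "\<forall>X \<in> Obj C. cofibrant C W F X \<and> final_fibrant C t F X"
    and "\<forall>f \<in> Arr C. f \<in> W \<longleftrightarrow> homotopy_equivalence C t W F f"
    and "is_initial C e"
    and "\<forall>f \<in> Arr C. \<forall>g \<in> Arr C.
           Dom C f = Dom C g \<and> (f \<in> cofibrations C W F \<or> g \<in> cofibrations C W F) \<longrightarrow>
           (\<exists>p q. is_pushout C f g p q)"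
    and "\<forall>X \<in> Obj C. \<forall>i1 i2 d.
           is_coproduct C X X i1 i2 \<and> is_copairing C i1 i2 (Id C X) (Id C X) d \<longrightarrow>
           (\<exists>i \<in> cofibrations C W F. \<exists>w \<in> W. Cod C i = Dom C w \<and> w \<cdot>\<^bsub>C\<^esub> i = d)"
  shows "cofibration_category C e W (cofibrations C W F) \<and>
    (\<forall>X \<in> Obj C. initial_cofibrant C e (cofibrations C W F) X \<and>
                  fibrant C W (cofibrations C W F) X)"
proof -
  interpret cylinder_fibration_category C t W F e
    unfolding cylinder_fibration_category_def cylinder_fibration_category_axioms_def
      bifibrant_fibration_category_def bifibrant_fibration_category_axioms_def
    using assms by blast
  show ?thesis
    using is_cofibration_category all_initial_cofibrant all_cof_fibrant by blast
qed

end
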